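(* Let $d,T\in\mathbb{N}$, $L>0$, and let $\eta_1,\dots,\eta_T>0$. Consider a noisy iterative algorithm in $\mathbb{R}^d$ with update rule $W_t=g(W_{t-1})-\eta_tF(W_{t-1},Z_t)+\xi_t$, $1\le t\le T$, as described in the context, with final output $W$ (a function of $W^T=(W_1,\dots,W_T)$). Suppose that for every $t$ the noise $\xi_t$ has i.i.d. components with common density $f_{t0}:\mathbb{R}\to\mathbb{R}$, so that $\xi_t$ has density $f_t(x)=\prod_{i=1}^df_{t0}(x_i)$, and that $f_{t0}$ is symmetric around $0$ and non-increasing over $[0,\infty)$. Suppose further that $P(Z_{t+1}\mid Z^t,W^t,S)=P(Z_{t+1}\mid Z^t,S)$ for all $t$ and that $\sup_{w,z}\|F(w,z)\|_\infty\le L$. Then $$\mathcal{L}(S\to W)\le\sum_{t=1}^Td\,\log\big(1+2\eta_tL\,f_{t0}(0)\big).$$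
   Context: Maximal leakage: for random variables $X,Y$ with joint law $P_{XY}$, $\mathcal{L}(X\to Y)=I_\infty(X,Y)=\min_{Q_Y}D_\infty(P_{XY}\|P_XQ_Y)=\log\mathbb{E}_{P_Y}\big[\operatorname{ess\,sup}_{P_X}\frac{dP_{XY}}{d(P_XP_Y)}\big]$, where $D_\infty$ is the Rényi divergence of order $\infty$. If $X,Y$ are jointly continuous this equals $\log\int\operatorname{ess\,sup}_{P_X}f_{Y|X}(y|x)\,dy$. Logarithms are natural. Setup: $S=(Z'_1,\dots,Z'_n)$ is a data set of $n$ i.i.d. samples from an unknown distribution on a sample space $\mathcal{Z}$. The algorithm generates $W_t=g(W_{t-1})-\eta_tF(W_{t-1},Z_t)+\xi_t$ for $t=1,\dots,T$, where $Z_t\subseteq S$ is a (possibly random) subset (mini-batch) of the data sampled according to some distribution, $g:\mathbb{R}^d\to\mathbb{R}^d$ is a deterministic function, $F(w,z)\in\mathbb{R}^d$ is a direction (e.g. a gradient), $\eta_t$ is the step-size, and $\xi_t$ is an $\mathbb{R}^d$-valued noise with an absolutely continuous distribution. The initial point $W_0$ is independent of $(S,Z_1,\dots,Z_T)$, and the noises $\xi_1,\dots,\xi_T$ are mutually independent and independent of $(W_0,S,Z_1,\dots,Z_T)$; thus $P(W_{t+1}\mid W^t,Z^T,S)=P(W_{t+1}\mid W_t,Z_{t+1})$. Notation: $W^t=(W_1,\dots,W_t)$, $Z^t=(Z_1,\dots,Z_t)$, $\|x\|_\infty=\max_i|x_i|$. *)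

theory Defs
  imports "HOL-Probability.Probability"
begin

definition ln_ennreal :: "ennreal \<Rightarrow> ereal" where
  "ln_ennreal x = (if x = 0 then -\<infinity> else if x = \<top> then \<infinity> else ereal (ln (enn2real x)))"

text \<open>Renyi divergence of order infinity of \<open>P\<close> from \<open>Q\<close>. Note the argument order of
  \<^const>\<open>RN_deriv\<close>: the derivative dP/dQ is \<open>RN_deriv Q P\<close>.\<close>

definition renyi_divergence_infty :: "'a measure \<Rightarrow> 'a measure \<Rightarrow> ereal" where
  "renyi_divergence_infty P Q =
     (if absolutely_continuous Q P then ln_ennreal (esssup P (RN_deriv Q P)) else \<infinity>)"

text \<open>Sibson form of maximal leakage: the infimum ranges over all probability measures on the
  target space of \<open>Y\<close>.\<close>

definition maximal_leakage ::
  "'a measure \<Rightarrow> 'b measure \<Rightarrow> 'c measure \<Rightarrow> ('a \<Rightarrow> 'b) \<Rightarrow> ('a \<Rightarrow> 'c) \<Rightarrow> ereal" where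
  "maximal_leakage M N\<^sub>X N\<^sub>Y X Y =
     (INF Q \<in> {Q. prob_space Q \<and> sets Q = sets N\<^sub>Y}.
        renyi_divergence_infty
          (distr M (N\<^sub>X \<Otimes>\<^sub>M N\<^sub>Y) (\<lambda>\<omega>. (X \<omega>, Y \<omega>)))
          (distr M N\<^sub>X X \<Otimes>\<^sub>M Q))"

text \<open>The library's \<open>indep_var\<close> forces both variables to have the same value type; here the types
  may differ.\<close>

definition indep_rv ::
  "'a measure \<Rightarrow> 'b measure \<Rightarrow> ('a \<Rightarrow> 'b) \<Rightarrow> 'c measure \<Rightarrow> ('a \<Rightarrow> 'c) \<Rightarrow> bool" where
  "indep_rv M N\<^sub>X X N\<^sub>Y Y \<longleftrightarrow>
     X \<in> measurable M N\<^sub>X \<and> Y \<in> measurable M N\<^sub>Y \<and>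
     prob_space.indep_set M
       (sets (vimage_algebra (space M) X N\<^sub>X)) (sets (vimage_algebra (space M) Y N\<^sub>Y))"

text \<open>\<open>cond_prob_rv M N X A\<close> is (a version of) the conditional probability P(A | X), for \<open>X\<close> with
  values in \<open>N\<close>.\<close>

definition cond_prob_rv ::
  "'a measure \<Rightarrow> 'b measure \<Rightarrow> ('a \<Rightarrow> 'b) \<Rightarrow> 'a set \<Rightarrow> 'a \<Rightarrow> real" where
  "cond_prob_rv M N X A = real_cond_exp M (vimage_algebra (space M) X N) (indicator A)"

text \<open>Mini-batches of a data set of \<open>n\<close> samples: multisets (a data set may contain repeated samples)
  of at most \<open>n\<close> points, with the smallest sigma-algebra that makes the number of points in each
  measurable set measurable.\<close>

definition batch_space :: "nat \<Rightarrow> 'z measure \<Rightarrow> 'z multiset measure" where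
  "batch_space n N =
     (let \<Omega> = {m. set_mset m \<subseteq> space N \<and> size m \<le> n}
      in sigma \<Omega> {{m \<in> \<Omega>. size (filter_mset (\<lambda>x. x \<in> A) m) = k} | A k. A \<in> sets N})"

definition dataset_mset :: "nat \<Rightarrow> (nat \<Rightarrow> 'z) \<Rightarrow> 'z multiset" where
  "dataset_mset n s = image_mset s (mset_set {..<n})"

definition history :: "(nat \<Rightarrow> 'a \<Rightarrow> 'b) \<Rightarrow> nat \<Rightarrow> 'a \<Rightarrow> nat \<Rightarrow> 'b" where
  "history X t \<omega> = (\<lambda>k\<in>{1..t}. X k \<omega>)"

abbreviation history_space :: "'b measure \<Rightarrow> nat \<Rightarrow> (nat \<Rightarrow> 'b) measure" where
  "history_space N t \<equiv> Pi\<^sub>M {1..t} (\<lambda>_. N)"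

end

theory Submission
  imports Defs
begin

text \<open>
  Given the data set and the mini-batches, the iterates are a function of \<open>W 0\<close> and of the noise.
  Since \<open>F\<close> moves every coordinate of the \<open>t\<close>-th step by at most \<open>a = \<eta> t * L\<close>, the density of a
  coordinate of the shifted noise is bounded by the envelope \<open>f t (max 0 (\<bar>x\<bar> - a))\<close>, of mass
  \<open>1 + 2 * a * f t 0\<close>. Hence the joint law of data and iterates is at most \<open>C\<close> times the product of
  the law of the data with the law of the path whose drift is \<open>g\<close> alone and whose noise is
  distributed as the normalised envelope, where \<open>C\<close> is the product of the masses over all steps and
  coordinates. This bounds the divergence from that product by \<open>ln C\<close>.
\<close>

section \<open>Bounding maximal leakage by domination of the joint law\<close>

text \<open>Turns the sigma-algebra form of \<open>indep_rv\<close> into a product law, so that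
  integrals over the joint law can be iterated. It suffices to compare the two measures on
  rectangles, where independence is exactly the product rule.\<close>

lemma distr_Pair_indep_rv:
  assumes "prob_space M" and "indep_rv M A X B Y"
  shows "distr M (A \<Otimes>\<^sub>M B) (\<lambda>\<omega>. (X \<omega>, Y \<omega>)) = distr M A X \<Otimes>\<^sub>M distr M B Y"
proof (rule pair_measure_eqI[symmetric])
  interpret prob_space M by fact
  have X [measurable]: "X \<in> measurable M A" and Y [measurable]: "Y \<in> measurable M B"
    and ind: "indep_set (sets (vimage_algebra (space M) X A)) (sets (vimage_algebra (space M) Y B))"
    using assms(2) by (auto simp: indep_rv_def)
  show "sigma_finite_measure (distr M A X)" "sigma_finite_measure (distr M B Y)"
    by (auto intro!: prob_space_imp_sigma_finite prob_space_distr)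
  show "sets (distr M A X \<Otimes>\<^sub>M distr M B Y) = sets (distr M (A \<Otimes>\<^sub>M B) (\<lambda>\<omega>. (X \<omega>, Y \<omega>)))"
    by (simp cong: sets_pair_measure_cong)
  fix U V assume "U \<in> sets (distr M A X)" "V \<in> sets (distr M B Y)"
  then have U [measurable]: "U \<in> sets A" and V [measurable]: "V \<in> sets B" by auto
  have "prob ((X -` U \<inter> space M) \<inter> (Y -` V \<inter> space M)) = prob (X -` U \<inter> space M) * prob (Y -` V \<inter> space M)"
    by (rule indep_setD[OF ind]) (use U V in \<open>auto intro!: in_vimage_algebra\<close>)
  moreover have "(\<lambda>\<omega>. (X \<omega>, Y \<omega>)) -` (U \<times> V) \<inter> space M = (X -` U \<inter> space M) \<inter> (Y -` V \<inter> space M)"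
    by auto
  ultimately show "emeasure (distr M A X) U * emeasure (distr M B Y) V
      = emeasure (distr M (A \<Otimes>\<^sub>M B) (\<lambda>\<omega>. (X \<omega>, Y \<omega>))) (U \<times> V)"
    by (simp add: emeasure_distr emeasure_eq_measure ennreal_mult)
qed

lemma ln_ennreal_le:
  assumes "x \<le> ennreal C" "C > 0"
  shows "ln_ennreal x \<le> ereal (ln C)"
proof -
  have fin: "x < \<top>" using assms(1) ennreal_less_top le_less_trans by blast
  moreover have "ln (enn2real x) \<le> ln C" if "x \<noteq> 0"
  proof -
    have "0 < enn2real x" using that fin by (simp add: enn2real_positive_iff zero_less_iff_neq_zero)
    moreover have "enn2real x \<le> C" using assms by (simp add: enn2real_leI)
    ultimately show ?thesis using assms(2) by simp
  qed
  ultimately show ?thesis by (auto simp: ln_ennreal_def)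
qed

text \<open>If the derivative exceeded \<open>C\<close> on a set \<open>A\<close> of positive
  measure, integrating it over \<open>A\<close> would give \<open>N\<close> more mass there than
  \<open>C * emeasure M A\<close>, against the domination.\<close>

lemma (in sigma_finite_measure) RN_deriv_le_AE:
  assumes "finite_measure N" and sets: "sets N = sets M"
    and le: "\<And>A. A \<in> sets M \<Longrightarrow> emeasure N A \<le> C * emeasure M A"
  shows "absolutely_continuous M N" and "AE x in M. RN_deriv M N x \<le> C"
proof -
  interpret N: finite_measure N by fact
  show ac: "absolutely_continuous M N"
    unfolding absolutely_continuous_def null_sets_def using le sets by fastforce
  define A where "A = {x \<in> space M. C < RN_deriv M N x}"
  have A [measurable]: "A \<in> sets M" unfolding A_def by measurable
  have N: "emeasure N A = (\<integral>\<^sup>+ x. RN_deriv M N x * indicator A x \<partial>M)"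
    using density_RN_deriv[OF ac sets] by (metis A borel_measurable_RN_deriv emeasure_density)
  have "emeasure M A = 0"
  proof (rule ccontr)
    assume nz: "emeasure M A \<noteq> 0"
    have "C * emeasure M A = (\<integral>\<^sup>+ x. C * indicator A x \<partial>M)" by (simp add: nn_integral_cmult_indicator)
    also have "\<dots> < (\<integral>\<^sup>+ x. RN_deriv M N x * indicator A x \<partial>M)"
    proof (rule nn_integral_less)
      \<comment> \<open>Strict comparison of the integrals requires the smaller one to be finite;
        the finite measure \<open>N\<close> supplies the bound, whatever \<open>M\<close> and
        \<open>C\<close> are.\<close>
      have "(\<integral>\<^sup>+ x. C * indicator A x \<partial>M) \<le> emeasure N A"
        unfolding N by (rule nn_integral_mono) (auto simp: A_def indicator_def)
      then show "(\<integral>\<^sup>+ x. C * indicator A x \<partial>M) \<noteq> \<infinity>"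
        using N.emeasure_finite[of A] by (auto simp: top_unique)
      show "AE x in M. C * indicator A x \<le> RN_deriv M N x * indicator A x"
        by (auto simp: A_def indicator_def)
      show "\<not> (AE x in M. RN_deriv M N x * indicator A x \<le> C * indicator A x)"
      proof
        assume "AE x in M. RN_deriv M N x * indicator A x \<le> C * indicator A x"
        then have "AE x in M. x \<notin> A" by eventually_elim (auto simp: A_def indicator_def split: if_splits)
        then show False using nz by (subst (asm) AE_iff_measurable[OF A]) (use sets.sets_into_space[OF A] in auto)
      qed
    qed auto
    finally show False using le[OF A] N by auto
  qed
  then show "AE x in M. RN_deriv M N x \<le> C"
    by (subst AE_iff_measurable[OF A]) (auto simp: A_def not_le)
qed

lemma renyi_divergence_infty_le:
  assumes "prob_space P" "prob_space Q" and sets: "sets P = sets Q"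
    and le: "\<And>A. A \<in> sets Q \<Longrightarrow> emeasure P A \<le> ennreal C * emeasure Q A"
    and "C > 0"
  shows "renyi_divergence_infty P Q \<le> ereal (ln C)"
proof -
  interpret P: prob_space P by fact
  interpret Q: prob_space Q by fact
  have *: "absolutely_continuous Q P" "AE x in Q. RN_deriv Q P x \<le> ennreal C"
    using Q.RN_deriv_le_AE[OF P.finite_measure_axioms sets, of "ennreal C"] le by auto
  \<comment> \<open>The essential supremum is taken under \<open>P\<close>, while the bound holds
    \<open>Q\<close>-almost everywhere; absolute continuity carries it over.\<close>
  have "AE x in P. RN_deriv Q P x \<le> ennreal C"
    using *(2) by (rule absolutely_continuous_AE[OF sets *(1)])
  then have "esssup P (RN_deriv Q P) \<le> ennreal C"
    by (intro esssup_I) (simp_all add: measurable_cong_sets[OF sets refl])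
  with *(1) \<open>C > 0\<close> show ?thesis
    by (simp add: renyi_divergence_infty_def ln_ennreal_le)
qed

text \<open>The leakage is an infimum over \<open>Q\<close>, so one well-chosen \<open>Q\<close> is
  enough: any product of the law of \<open>X\<close> with a fixed probability measure that dominates
  the joint law up to the factor \<open>C\<close>.\<close>

lemma maximal_leakage_le:
  assumes "prob_space M" and X: "X \<in> measurable M A" and Y: "Y \<in> measurable M B"
    and "prob_space Q" and Q: "sets Q = sets B" and "C > 0"
    and le: "\<And>E. E \<in> sets (A \<Otimes>\<^sub>M B) \<Longrightarrow>
      emeasure (distr M (A \<Otimes>\<^sub>M B) (\<lambda>\<omega>. (X \<omega>, Y \<omega>))) E
        \<le> ennreal C * emeasure (distr M A X \<Otimes>\<^sub>M Q) E"
  shows "maximal_leakage M A B X Y \<le> ereal (ln C)"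
proof -
  interpret prob_space M by fact
  interpret Q: prob_space Q by fact
  interpret X: prob_space "distr M A X" using X by (rule prob_space_distr)
  interpret XQ: pair_prob_space "distr M A X" Q ..
  have sets: "sets (distr M A X \<Otimes>\<^sub>M Q) = sets (A \<Otimes>\<^sub>M B)"
    by (rule sets_pair_measure_cong) (simp_all add: Q)
  have "renyi_divergence_infty (distr M (A \<Otimes>\<^sub>M B) (\<lambda>\<omega>. (X \<omega>, Y \<omega>))) (distr M A X \<Otimes>\<^sub>M Q)
      \<le> ereal (ln C)"
  proof (rule renyi_divergence_infty_le)
    show "prob_space (distr M (A \<Otimes>\<^sub>M B) (\<lambda>\<omega>. (X \<omega>, Y \<omega>)))"
      using X Y by (intro prob_space_distr) measurable
  qed (use sets le \<open>C > 0\<close> XQ.prob_space_axioms in auto)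
  then show ?thesis
    unfolding maximal_leakage_def by (rule INF_lower2[rotated]) (use Q Q.prob_space_axioms in simp)
qed

section \<open>The envelope of a shifted density on the line\<close>

text \<open>For \<open>a \<ge> 0\<close> and an even \<open>f\<close> that is non-increasing on the
  positive half-line, this is the pointwise supremum of \<open>f (x - u)\<close> over all shifts
  with \<open>\<bar>u\<bar> \<le> a\<close>: the best shift moves \<open>x\<close> towards the
  origin by \<open>a\<close>, or onto it.\<close>

definition envelope :: "(real \<Rightarrow> real) \<Rightarrow> real \<Rightarrow> real \<Rightarrow> real" where
  "envelope f a x = f (max 0 (\<bar>x\<bar> - a))"

text \<open>By evenness only \<open>\<bar>x - u\<bar>\<close> matters, and the triangle inequality
  keeps it above \<open>\<bar>x\<bar> - a\<close>.\<close>

lemma le_envelope: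
  assumes even: "\<And>x. f (- x) = f x" and mono: "antimono_on {0..} f" and "\<bar>u\<bar> \<le> a"
  shows "f (x - u) \<le> envelope f a x"
proof -
  have "f (x - u) = f \<bar>x - u\<bar>" using even[of "x - u"] by (simp add: abs_if)
  also have "\<dots> \<le> f (max 0 (\<bar>x\<bar> - a))"
    by (rule monotone_onD[OF mono]) (use \<open>\<bar>u\<bar> \<le> a\<close> in auto)
  finally show ?thesis by (simp add: envelope_def)
qed

text \<open>The graph of \<open>f\<close> is cut at the origin and its halves are pushed apart by
  \<open>a\<close> each. The halves keep their total mass 1, and the gap is filled by a plateau of
  width \<open>2 * a\<close> and height \<open>f 0\<close>.\<close>

lemma nn_integral_envelope:
  assumes [measurable]: "(\<lambda>x. ennreal (f x)) \<in> borel_measurable borel"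
    and nonneg: "\<And>x. f x \<ge> 0"
    and even: "\<And>x. f (- x) = f x"
    and int: "(\<integral>\<^sup>+ x. ennreal (f x) \<partial>lborel) = 1"
    and "a \<ge> 0"
  shows "(\<integral>\<^sup>+ x. ennreal (envelope f a x) \<partial>lborel) = ennreal (1 + 2 * a * f 0)"
proof -
  have "ennreal (envelope f a x) = ennreal (f 0) * indicator {-a..a} x
      + (ennreal (f (x - a)) * indicator {a<..} x + ennreal (f (x + a)) * indicator {..<-a} x)" for x
  proof -
    consider "x \<in> {-a..a}" | "a < x" | "x < -a" by fastforce
    then show ?thesis
    proof cases
      case 1
      then have "max 0 (\<bar>x\<bar> - a) = 0" by auto
      with 1 show ?thesis by (auto simp: envelope_def)
    next
      case 2
      then show ?thesis using \<open>a \<ge> 0\<close> by (auto simp: envelope_def)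
    next
      case 3
      then show ?thesis using \<open>a \<ge> 0\<close> even[of "x + a"] by (auto simp: envelope_def)
    qed
  qed
  then have "(\<integral>\<^sup>+ x. ennreal (envelope f a x) \<partial>lborel) = (\<integral>\<^sup>+ x. ennreal (f 0) * indicator {-a..a} x \<partial>lborel)
      + ((\<integral>\<^sup>+ x. ennreal (f (x - a)) * indicator {a<..} x \<partial>lborel)
        + (\<integral>\<^sup>+ x. ennreal (f (x + a)) * indicator {..<-a} x \<partial>lborel))"
    by (simp add: nn_integral_add)
  also have "(\<integral>\<^sup>+ x. ennreal (f 0) * indicator {-a..a} x \<partial>lborel) = ennreal (2 * a * f 0)"
    using \<open>a \<ge> 0\<close> nonneg by (simp add: nn_integral_cmult_indicator ennreal_mult' mult.commute)
  also have "(\<integral>\<^sup>+ x. ennreal (f (x - a)) * indicator {a<..} x \<partial>lborel)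
      = (\<integral>\<^sup>+ x. ennreal (f x) * indicator {0<..} x \<partial>lborel)"
    by (subst nn_integral_real_affine[where t = a and c = 1]) (auto intro!: nn_integral_cong simp: indicator_def)
  also have "(\<integral>\<^sup>+ x. ennreal (f (x + a)) * indicator {..<-a} x \<partial>lborel)
      = (\<integral>\<^sup>+ x. ennreal (f x) * indicator {..<0} x \<partial>lborel)"
    by (subst nn_integral_real_affine[where t = "-a" and c = 1]) (auto intro!: nn_integral_cong simp: indicator_def)
  also have "(\<integral>\<^sup>+ x. ennreal (f x) * indicator {0<..} x \<partial>lborel)
      + (\<integral>\<^sup>+ x. ennreal (f x) * indicator {..<0} x \<partial>lborel) = (\<integral>\<^sup>+ x. ennreal (f x) \<partial>lborel)"
  proof (subst nn_integral_add[symmetric])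
    \<comment> \<open>The two open half-lines together miss only the origin, a null set.\<close>
    have "AE x in lborel. x \<noteq> (0::real)" by (rule AE_lborel_singleton)
    then show "(\<integral>\<^sup>+ x. ennreal (f x) * indicator {0<..} x + ennreal (f x) * indicator {..<0} x \<partial>lborel)
        = (\<integral>\<^sup>+ x. ennreal (f x) \<partial>lborel)"
      by (intro nn_integral_cong_AE, eventually_elim) (auto simp: indicator_def)
  qed auto
  finally show ?thesis
    using int \<open>a \<ge> 0\<close> nonneg by (simp add: add.commute flip: ennreal_1 ennreal_plus)
qed

definition envelope_measure :: "(real \<Rightarrow> real) \<Rightarrow> real \<Rightarrow> real measure" where
  "envelope_measure f a = density lborel (\<lambda>x. ennreal (envelope f a x) / ennreal (1 + 2 * a * f 0))"

lemma envelope_measurable: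
  assumes [measurable]: "(\<lambda>x. ennreal (f x)) \<in> borel_measurable borel"
  shows "(\<lambda>x. ennreal (envelope f a x)) \<in> borel_measurable borel"
  unfolding envelope_def by measurable

lemma prob_space_envelope_measure:
  assumes f: "(\<lambda>x. ennreal (f x)) \<in> borel_measurable borel"
    and nonneg: "\<And>x. f x \<ge> 0"
    and even: "\<And>x. f (- x) = f x"
    and int: "(\<integral>\<^sup>+ x. ennreal (f x) \<partial>lborel) = 1"
    and "a \<ge> 0"
  shows "prob_space (envelope_measure f a)"
proof
  note [measurable] = envelope_measurable[OF f]
  have "1 + 2 * a * f 0 > 0" using \<open>a \<ge> 0\<close> nonneg[of 0] by (simp add: add_pos_nonneg)
  then show "emeasure (envelope_measure f a) (space (envelope_measure f a)) = 1"
    unfolding envelope_measure_def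
    by (simp add: emeasure_density nn_integral_divide nn_integral_envelope[OF assms] ennreal_divide_self)
qed

text \<open>A change of variable moves the shift from the test function into the density, where the
  envelope removes the dependence on \<open>u\<close>. The factor in front is the normalising
  constant of \<open>envelope_measure\<close>.\<close>

lemma nn_integral_shift_le_envelope_measure:
  assumes f [measurable]: "(\<lambda>x. ennreal (f x)) \<in> borel_measurable borel"
    and nonneg: "\<And>x. f x \<ge> 0"
    and even: "\<And>x. f (- x) = f x"
    and mono: "antimono_on {0..} f"
    and u: "\<bar>u\<bar> \<le> a"
    and h [measurable]: "h \<in> borel_measurable borel"
  shows "(\<integral>\<^sup>+ x. h (x + u) \<partial>density lborel f)
    \<le> ennreal (1 + 2 * a * f 0) * (\<integral>\<^sup>+ x. h x \<partial>envelope_measure f a)"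
proof -
  note [measurable] = envelope_measurable[OF f]
  have pos: "1 + 2 * a * f 0 > 0" using u nonneg[of 0] by (simp add: add_pos_nonneg)
  then have c: "ennreal (1 + 2 * a * f 0) * (x / ennreal (1 + 2 * a * f 0)) = x" for x
    by (subst ennreal_times_divide, subst mult.commute, intro ennreal_mult_divide_eq) auto
  have "(\<integral>\<^sup>+ x. h (x + u) \<partial>density lborel f) = (\<integral>\<^sup>+ x. ennreal (f x) * h (x + u) \<partial>lborel)"
    by (simp add: nn_integral_density)
  also have "\<dots> = (\<integral>\<^sup>+ x. ennreal (f (x - u)) * h x \<partial>lborel)"
    by (subst nn_integral_real_affine[where t = "-u" and c = 1]) (auto simp: algebra_simps)
  also have "\<dots> \<le> (\<integral>\<^sup>+ x. ennreal (1 + 2 * a * f 0) * (ennreal (envelope f a x) / ennreal (1 + 2 * a * f 0) * h x) \<partial>lborel)"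
    unfolding mult.assoc[symmetric] c
    by (intro nn_integral_mono mult_right_mono ennreal_leI le_envelope even mono u) auto
  also have "\<dots> = ennreal (1 + 2 * a * f 0) * (\<integral>\<^sup>+ x. h x \<partial>envelope_measure f a)"
    unfolding envelope_measure_def by (simp add: nn_integral_density nn_integral_cmult)
  finally show ?thesis .
qed

section \<open>Comparing noisy paths step by step\<close>

text \<open>A deterministic function of start, drift and noise, so that all randomness enters
  through the arguments. The start sits at time 0 and the noise is read from index 1 on, which
  matches \<open>history\<close>.\<close>

primrec noisy_path :: "(nat \<Rightarrow> 'b \<Rightarrow> 'b) \<Rightarrow> 'b \<Rightarrow> (nat \<Rightarrow> 'b) \<Rightarrow> nat \<Rightarrow> 'b::plus" where
  "noisy_path D w x 0 = w"
| "noisy_path D w x (Suc t) = D (Suc t) (noisy_path D w x t) + x (Suc t)"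

lemma noisy_path_cong:
  assumes "\<And>k. k \<in> {1..t} \<Longrightarrow> x k = y k"
  shows "noisy_path D w x t = noisy_path D w y t"
  using assms by (induction t) auto

text \<open>The drift may depend on a parameter \<open>v\<close>, which allows a drift driven by the
  mini-batches; measurability is needed jointly in the parameter and the path.\<close>

lemma measurable_noisy_path:
  fixes D :: "'c \<Rightarrow> nat \<Rightarrow> 'b \<Rightarrow> 'b::{second_countable_topology, real_normed_vector}"
  assumes D: "\<And>t. t \<in> {1..n} \<Longrightarrow> (\<lambda>(v, w). D v t w) \<in> borel_measurable (A \<Otimes>\<^sub>M borel)"
    and v: "v \<in> measurable B A"
    and w: "w \<in> borel_measurable B"
    and x: "\<And>t. t \<in> {1..n} \<Longrightarrow> (\<lambda>b. x b t) \<in> borel_measurable B"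
    and "t \<le> n"
  shows "(\<lambda>b. noisy_path (D (v b)) (w b) (x b) t) \<in> borel_measurable B"
  using \<open>t \<le> n\<close>
proof (induction t)
  case 0
  then show ?case using w by simp
next
  case (Suc t)
  note IH = Suc.IH[OF Suc_leD[OF Suc.prems]]
  have s: "Suc t \<in> {1..n}" using Suc.prems by auto
  have "(\<lambda>b. (v b, noisy_path (D (v b)) (w b) (x b) t)) \<in> measurable B (A \<Otimes>\<^sub>M borel)"
    using v IH by measurable
  from measurable_compose[OF this D[OF s]] x[OF s] show ?case
    by simp
qed

text \<open>Induction on the number of steps, integrating out the last noise first. With the past
  frozen, the one-step bound exchanges the last drift and noise law at the price of one factor; what
  remains is a function of the shorter path. Time 0 is kept in the path so that the position
  \<open>v n\<close> preceding the last step exists even for \<open>n = 0\<close>.\<close>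

lemma nn_integral_noisy_path_le:
  fixes D D' :: "nat \<Rightarrow> 'b \<Rightarrow> 'b::{second_countable_topology, real_normed_vector}"
    and c :: "nat \<Rightarrow> ennreal"
  assumes P: "\<And>t. prob_space (P t)" "\<And>t. sets (P t) = sets borel"
    and Q: "\<And>t. prob_space (Q t)" "\<And>t. sets (Q t) = sets borel"
    and D: "\<And>t. t \<in> {1..n} \<Longrightarrow> D t \<in> borel_measurable borel"
    and D': "\<And>t. t \<in> {1..n} \<Longrightarrow> D' t \<in> borel_measurable borel"
    and step: "\<And>t w h. \<lbrakk>t \<in> {1..n}; h \<in> borel_measurable borel\<rbrakk> \<Longrightarrow>
        (\<integral>\<^sup>+ x. h (D t w + x) \<partial>P t) \<le> c t * (\<integral>\<^sup>+ x. h (D' t w + x) \<partial>Q t)"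
    and "h \<in> borel_measurable (Pi\<^sub>M {0..n} (\<lambda>_. borel))"
  shows "(\<integral>\<^sup>+ x. h (\<lambda>t\<in>{0..n}. noisy_path D w x t) \<partial>Pi\<^sub>M {1..n} P)
    \<le> (\<Prod>t=1..n. c t) * (\<integral>\<^sup>+ x. h (\<lambda>t\<in>{0..n}. noisy_path D' w x t) \<partial>Pi\<^sub>M {1..n} Q)"
  using D D' step assms(8)
proof (induction n arbitrary: h)
  case 0
  interpret P: prob_space "Pi\<^sub>M {1..0} P" by (intro prob_space_PiM P)
  interpret Q: prob_space "Pi\<^sub>M {1..0} Q" by (intro prob_space_PiM Q)
  have "{0..0::nat} = {0}" by auto
  then have "(\<lambda>t\<in>{0..0}. noisy_path E w x t) = (\<lambda>t\<in>{0..0}. w)" for E x by auto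
  then show ?case by (simp add: P.emeasure_space_1[simplified] Q.emeasure_space_1[simplified])
next
  case (Suc n)
  interpret P: product_sigma_finite P
    unfolding product_sigma_finite_def using P prob_space_imp_sigma_finite by blast
  interpret Q: product_sigma_finite Q
    unfolding product_sigma_finite_def using Q prob_space_imp_sigma_finite by blast
  have [measurable_cong]: "sets (P t) = sets borel" "sets (Q t) = sets borel" for t
    using P Q by auto
  note [measurable] = Suc.prems(4)
  have Dm [measurable]: "D (Suc n) \<in> borel_measurable borel" "D' (Suc n) \<in> borel_measurable borel"
    using Suc.prems by auto
  have ins: "{1..Suc n} = insert (Suc n) {1..n}" by auto
  have prod: "(\<Prod>t=1..Suc n. c t) * x = c (Suc n) * ((\<Prod>t=1..n. c t) * x)" for x
    by (simp add: mult_ac)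
  have ins0: "{0..Suc n} = insert (Suc n) {0..n}" by auto
  \<comment> \<open>The last noise affects only the last point of the path.\<close>
  have upd: "(\<lambda>t\<in>{0..Suc n}. noisy_path E w (x(Suc n := y)) t)
      = (\<lambda>t\<in>{0..n}. noisy_path E w x t)(Suc n := E (Suc n) (noisy_path E w x n) + y)" for E x y
  proof -
    have "noisy_path E w (x(Suc n := y)) t = noisy_path E w x t" if "t \<le> n" for t
      using that by (intro noisy_path_cong) auto
    then show ?thesis by (auto simp: restrict_def fun_eq_iff)
  qed
  have path: "(\<lambda>x. noisy_path E w x t) \<in> borel_measurable (Pi\<^sub>M {1..m} R)"
    if "\<And>t. t \<in> {1..m} \<Longrightarrow> E t \<in> borel_measurable borel" "\<And>t. sets (R t) = sets borel" "t \<le> m"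
    for E t R m
  \<comment> \<open>A parameter in the one-point type specialises the parametrised lemma to a fixed
    drift.\<close>
  proof (rule measurable_noisy_path[where D = "\<lambda>_::unit. E" and v = "\<lambda>_. ()" and A = "count_space UNIV" and n = m])
    fix t assume "t \<in> {1..m}"
    then show "(\<lambda>(v, w). E t w) \<in> borel_measurable (count_space UNIV \<Otimes>\<^sub>M borel)"
      using that(1)[of t] by simp
    show "(\<lambda>x. x t) \<in> borel_measurable (Pi\<^sub>M {1..m} R)"
      using \<open>t \<in> _\<close> measurable_component_singleton[of t "{1..m}" R]
      by (simp cong: measurable_cong_sets add: that(2) measurable_cong_sets[OF refl that(2)])
  qed (use that in auto)
  have pathr: "(\<lambda>x. \<lambda>t\<in>{0..m}. noisy_path E w x t) \<in> measurable (Pi\<^sub>M {1..m} R) (Pi\<^sub>M {0..m} (\<lambda>_. borel))"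
    if "\<And>t. t \<in> {1..m} \<Longrightarrow> E t \<in> borel_measurable borel" "\<And>t. sets (R t) = sets borel" for E R m
    by (rule measurable_restrict) (use path that in auto)
  have meas: "(\<lambda>x. h (\<lambda>t\<in>{0..Suc n}. noisy_path E w x t)) \<in> borel_measurable (Pi\<^sub>M (insert (Suc n) {1..n}) R)"
    if "\<And>t. t \<in> {1..Suc n} \<Longrightarrow> E t \<in> borel_measurable borel" "\<And>t. sets (R t) = sets borel" for E R
    using measurable_compose[OF pathr[OF that] Suc.prems(4)] unfolding ins .
  \<comment> \<open>In \<open>h'\<close> the last step is already taken with the dominating drift
    \<open>D'\<close> and noise law \<open>Q\<close>, so it is a test function of the path up to
    time \<open>n\<close> on both sides of the induction hypothesis.\<close>
  define h' where "h' v = (\<integral>\<^sup>+ y. h (v(Suc n := D' (Suc n) (v n) + y)) \<partial>Q (Suc n))" for v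
  have up: "(\<lambda>(v, y). v(Suc n := D' (Suc n) (v n) + y))
      \<in> measurable (Pi\<^sub>M {0..n} (\<lambda>_. borel) \<Otimes>\<^sub>M Q (Suc n)) (Pi\<^sub>M {0..Suc n} (\<lambda>_. borel))"
    unfolding ins0 case_prod_beta
    by (rule measurable_fun_upd[where J = "{0..n}"]) (auto intro!: measurable_compose[OF _ Dm(2)])
  have h': "h' \<in> borel_measurable (Pi\<^sub>M {0..n} (\<lambda>_. borel))"
    unfolding h'_def using measurable_compose[OF up Suc.prems(4)]
    by (intro sigma_finite_measure.borel_measurable_nn_integral[OF Q.sigma_finite_measures]) (simp add: case_prod_beta' fun_upd_def)
  \<comment> \<open>This is the test function fed to the one-step bound: the past is frozen and only
    the last point varies. Extensionality makes \<open>v\<close> a point of the product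
    space.\<close>
  have hm: "(\<lambda>z. h (v(Suc n := z))) \<in> borel_measurable borel" if "v \<in> extensional {0..n}" for v
  proof -
    have "(\<lambda>z. v(Suc n := z)) \<in> measurable borel (Pi\<^sub>M {0..Suc n} (\<lambda>_. borel))"
      unfolding ins0
      by (rule measurable_fun_upd[where J = "{0..n}"]) (use that in \<open>auto intro!: measurable_const simp: space_PiM PiE_def\<close>)
    from measurable_compose[OF this Suc.prems(4)] show ?thesis .
  qed
  have "(\<integral>\<^sup>+ x. h (\<lambda>t\<in>{0..Suc n}. noisy_path D w x t) \<partial>Pi\<^sub>M {1..Suc n} P)
      = (\<integral>\<^sup>+ x. \<integral>\<^sup>+ y. h (\<lambda>t\<in>{0..Suc n}. noisy_path D w (x(Suc n := y)) t) \<partial>P (Suc n) \<partial>Pi\<^sub>M {1..n} P)"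
    unfolding ins by (rule P.product_nn_integral_insert) (use meas[OF Suc.prems(1) P(2)] in auto)
  also have "\<dots> \<le> (\<integral>\<^sup>+ x. c (Suc n) * h' (\<lambda>t\<in>{0..n}. noisy_path D w x t) \<partial>Pi\<^sub>M {1..n} P)"
    unfolding upd
  proof (rule nn_integral_mono)
    fix x
    define v where "v = (\<lambda>t\<in>{0..n}. noisy_path D w x t)"
    have v: "v \<in> extensional {0..n}" "v n = noisy_path D w x n" by (auto simp: v_def)
    from Suc.prems(3)[OF _ hm[OF v(1)], of "Suc n" "v n"]
    show "(\<integral>\<^sup>+ y. h ((\<lambda>t\<in>{0..n}. noisy_path D w x t)(Suc n := D (Suc n) (noisy_path D w x n) + y)) \<partial>P (Suc n))
        \<le> c (Suc n) * h' (\<lambda>t\<in>{0..n}. noisy_path D w x t)"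
      unfolding h'_def v_def[symmetric] v(2)[symmetric] by simp
  qed
  also have "\<dots> = c (Suc n) * (\<integral>\<^sup>+ x. h' (\<lambda>t\<in>{0..n}. noisy_path D w x t) \<partial>Pi\<^sub>M {1..n} P)"
    by (intro nn_integral_cmult measurable_compose[OF pathr h'] P Suc.prems) auto
  also have "\<dots> \<le> c (Suc n) * ((\<Prod>t=1..n. c t) * (\<integral>\<^sup>+ x. h' (\<lambda>t\<in>{0..n}. noisy_path D' w x t) \<partial>Pi\<^sub>M {1..n} Q))"
    by (intro mult_left_mono Suc.IH h' Suc.prems) auto
  also have "(\<integral>\<^sup>+ x. h' (\<lambda>t\<in>{0..n}. noisy_path D' w x t) \<partial>Pi\<^sub>M {1..n} Q)
      = (\<integral>\<^sup>+ x. \<integral>\<^sup>+ y. h (\<lambda>t\<in>{0..Suc n}. noisy_path D' w (x(Suc n := y)) t) \<partial>Q (Suc n) \<partial>Pi\<^sub>M {1..n} Q)"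
    unfolding upd h'_def by simp
  also have "\<dots> = (\<integral>\<^sup>+ x. h (\<lambda>t\<in>{0..Suc n}. noisy_path D' w x t) \<partial>Pi\<^sub>M {1..Suc n} Q)"
    unfolding ins by (rule Q.product_nn_integral_insert[symmetric]) (use meas[OF Suc.prems(2) Q(2)] in auto)
  finally show ?case
    unfolding prod .
qed

section \<open>From one coordinate to noise vectors\<close>

text \<open>Domination tensorises: the coordinates are integrated out one at a time, each
  replacement of \<open>P i\<close> by \<open>Q i\<close> costing \<open>c i\<close>. The bound is
  phrased with test functions because the inner integrals are again test functions of the remaining
  coordinates.\<close>

lemma nn_integral_PiM_le:
  fixes c :: "'i \<Rightarrow> ennreal"
  assumes "finite I"
    and P: "\<And>i. sigma_finite_measure (P i)"
    and Q: "\<And>i. sigma_finite_measure (Q i)"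
    and \<tau>: "\<And>i. \<tau> i \<in> measurable (P i) (Q i)"
    and le: "\<And>i h. \<lbrakk>i \<in> I; h \<in> borel_measurable (Q i)\<rbrakk> \<Longrightarrow>
        (\<integral>\<^sup>+ x. h (\<tau> i x) \<partial>P i) \<le> c i * (\<integral>\<^sup>+ x. h x \<partial>Q i)"
    and "h \<in> borel_measurable (Pi\<^sub>M I Q)"
  shows "(\<integral>\<^sup>+ x. h (\<lambda>i\<in>I. \<tau> i (x i)) \<partial>Pi\<^sub>M I P) \<le> (\<Prod>i\<in>I. c i) * (\<integral>\<^sup>+ x. h x \<partial>Pi\<^sub>M I Q)"
  using \<open>finite I\<close> le assms(6)
proof (induction I arbitrary: h)
  case empty
  then show ?case by (simp add: PiM_empty nn_integral_count_space_finite)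
next
  case (insert i I)
  interpret P: product_sigma_finite P unfolding product_sigma_finite_def using P by blast
  interpret Q: product_sigma_finite Q unfolding product_sigma_finite_def using Q by blast
  have upd: "(\<lambda>j\<in>insert i I. \<tau> j ((x(i := y)) j)) = (\<lambda>j\<in>I. \<tau> j (x j))(i := \<tau> i y)" for x y
    using insert.hyps by (auto simp: restrict_def fun_eq_iff)
  have tm: "(\<lambda>x. \<lambda>j\<in>J. \<tau> j (x j)) \<in> measurable (Pi\<^sub>M J P) (Pi\<^sub>M J Q)" for J
    by (rule measurable_restrict) (auto intro!: measurable_compose[OF _ \<tau>])
  have hm: "(\<lambda>z. h (v(i := z))) \<in> borel_measurable (Q i)" if "v \<in> space (Pi\<^sub>M I Q)" for v
  proof -
    have "(\<lambda>z. v(i := z)) \<in> measurable (Q i) (Pi\<^sub>M (insert i I) Q)"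
      by (rule measurable_fun_upd[where J = I]) (use that in auto)
    from measurable_compose[OF this insert.prems(2)] show ?thesis .
  qed
  define h' where "h' v = (\<integral>\<^sup>+ y. h (v(i := y)) \<partial>Q i)" for v
  have up: "(\<lambda>(v, y). v(i := y)) \<in> measurable (Pi\<^sub>M I Q \<Otimes>\<^sub>M Q i) (Pi\<^sub>M (insert i I) Q)"
    by (rule measurable_add_dim)
  have h': "h' \<in> borel_measurable (Pi\<^sub>M I Q)"
    unfolding h'_def using measurable_compose[OF up insert.prems(2)]
    by (intro sigma_finite_measure.borel_measurable_nn_integral[OF Q.sigma_finite_measures]) (simp add: case_prod_beta' fun_upd_def)
  have "(\<integral>\<^sup>+ x. h (\<lambda>j\<in>insert i I. \<tau> j (x j)) \<partial>Pi\<^sub>M (insert i I) P)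
      = (\<integral>\<^sup>+ x. \<integral>\<^sup>+ y. h (\<lambda>j\<in>insert i I. \<tau> j ((x(i := y)) j)) \<partial>P i \<partial>Pi\<^sub>M I P)"
    by (rule P.product_nn_integral_insert[OF insert.hyps measurable_compose[OF tm insert.prems(2)]])
  also have "\<dots> \<le> (\<integral>\<^sup>+ x. c i * h' (\<lambda>j\<in>I. \<tau> j (x j)) \<partial>Pi\<^sub>M I P)"
    unfolding upd h'_def
    by (rule nn_integral_mono) (use insert.prems(1)[OF _ hm] measurable_space[OF tm] in auto)
  also have "\<dots> = c i * (\<integral>\<^sup>+ x. h' (\<lambda>j\<in>I. \<tau> j (x j)) \<partial>Pi\<^sub>M I P)"
    by (intro nn_integral_cmult measurable_compose[OF tm h'])
  also have "\<dots> \<le> c i * ((\<Prod>i\<in>I. c i) * (\<integral>\<^sup>+ x. h' x \<partial>Pi\<^sub>M I Q))"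
    by (intro mult_left_mono insert.IH h' insert.prems) auto
  also have "(\<integral>\<^sup>+ x. h' x \<partial>Pi\<^sub>M I Q) = (\<integral>\<^sup>+ x. h x \<partial>Pi\<^sub>M (insert i I) Q)"
    unfolding h'_def
    by (rule Q.product_nn_integral_insert[symmetric]) (use insert in auto)
  finally show ?case
    using insert.hyps by (simp add: mult_ac)
qed

lemma measurable_vec_lambda:
  "(\<lambda>x. \<chi> i. x i) \<in> borel_measurable (Pi\<^sub>M (UNIV :: 'd::finite set) (\<lambda>_. borel :: real measure))"
  by (subst borel_measurable_euclidean_space)
     (auto simp: Basis_vec_def inner_axis intro!: measurable_component_singleton)

text \<open>The vector law with independent coordinates distributed as
  \<open>envelope_measure\<close>; the product measure lives on functions and is transported to
  vectors.\<close>

definition envelope_noise :: "(real \<Rightarrow> real) \<Rightarrow> real \<Rightarrow> (real ^ 'd) measure" where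
  "envelope_noise f a = distr (Pi\<^sub>M UNIV (\<lambda>_. envelope_measure f a)) borel (\<lambda>x. \<chi> i. x i)"

lemma measurable_vec_lambda_envelope:
  "(\<lambda>x. \<chi> i. x i) \<in> borel_measurable (Pi\<^sub>M (UNIV :: 'd::finite set) (\<lambda>_. envelope_measure f a))"
proof -
  have "sets (Pi\<^sub>M (UNIV :: 'd set) (\<lambda>_. envelope_measure f a)) = sets (Pi\<^sub>M UNIV (\<lambda>_. borel))"
    by (intro sets_PiM_cong) (simp_all add: envelope_measure_def)
  then show ?thesis
    using measurable_vec_lambda by (simp cong: measurable_cong_sets)
qed

lemma prob_space_envelope_noise:
  assumes "(\<lambda>x. ennreal (f x)) \<in> borel_measurable borel"
    and "\<And>x. f x \<ge> 0" and "\<And>x. f (- x) = f x"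
    and "(\<integral>\<^sup>+ x. ennreal (f x) \<partial>lborel) = 1" and "a \<ge> 0"
  shows "prob_space (envelope_noise f a)"
  unfolding envelope_noise_def
  by (intro prob_space.prob_space_distr prob_space_PiM prob_space_envelope_measure assms
      measurable_vec_lambda_envelope)

text \<open>Independent components turn the law of \<open>X\<close> into a product, and a shift of
  the vector shifts each coordinate by at most \<open>a\<close>. The one-dimensional bound is thus
  paid once per coordinate, whence the exponent.\<close>

lemma nn_integral_shift_le_envelope_noise:
  fixes X :: "'a \<Rightarrow> real ^ 'd" and u :: "real ^ 'd"
  assumes "prob_space M"
    and indep: "prob_space.indep_vars M (\<lambda>_. borel) (\<lambda>i \<omega>. X \<omega> $ i) UNIV"
    and distr: "\<And>i. distributed M lborel (\<lambda>\<omega>. X \<omega> $ i) (\<lambda>x. ennreal (f x))"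
    and f: "(\<lambda>x. ennreal (f x)) \<in> borel_measurable borel"
    and nonneg: "\<And>x. f x \<ge> 0" and even: "\<And>x. f (- x) = f x"
    and int: "(\<integral>\<^sup>+ x. ennreal (f x) \<partial>lborel) = 1"
    and mono: "antimono_on {0..} f"
    and u: "\<And>i. \<bar>u $ i\<bar> \<le> a" and h: "h \<in> borel_measurable borel"
  shows "(\<integral>\<^sup>+ x. h (x + u) \<partial>distr M borel X)
    \<le> ennreal (1 + 2 * a * f 0) ^ CARD('d) * (\<integral>\<^sup>+ x. h x \<partial>envelope_noise f a)"
proof -
  interpret prob_space M by fact
  \<comment> \<open>Here \<open>undefined\<close> stands for an arbitrary index, as the index type
    is nonempty.\<close>
  have a: "a \<ge> 0" using u[of undefined] by linarith
  have Xi [measurable]: "(\<lambda>\<omega>. X \<omega> $ i) \<in> borel_measurable M" for i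
    using distributed_measurable[OF distr[of i]] by simp
  define P :: "'d \<Rightarrow> real measure" where "P = (\<lambda>_. density lborel f)"
  define Q :: "'d \<Rightarrow> real measure" where "Q = (\<lambda>_. envelope_measure f a)"
  have setsQ: "sets (Q i) = sets borel" for i by (simp add: Q_def envelope_measure_def)
  have law: "distr M borel (\<lambda>\<omega>. X \<omega> $ i) = density lborel f" for i
    using distributed_distr_eq_density[OF distr[of i]] by (simp cong: distr_cong)
  have "prob_space (density lborel f)"
    using law[of undefined] prob_space_distr[OF Xi[of undefined]] by simp
  then have P: "sigma_finite_measure (P i)" for i unfolding P_def by (rule prob_space_imp_sigma_finite)
  have Q: "sigma_finite_measure (Q i)" for i
    unfolding Q_def by (intro prob_space_imp_sigma_finite prob_space_envelope_measure f nonneg even int a)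
  have joint: "distr M (Pi\<^sub>M UNIV (\<lambda>_. borel)) (\<lambda>\<omega>. \<lambda>i\<in>UNIV. X \<omega> $ i) = Pi\<^sub>M UNIV P"
    using indep by (subst (asm) indep_vars_iff_distr_eq_PiM) (auto simp: law P_def)
  have m: "(\<lambda>\<omega>. \<lambda>i\<in>UNIV. X \<omega> $ i) \<in> measurable M (Pi\<^sub>M UNIV (\<lambda>_. borel))"
    by (rule measurable_restrict) simp
  have "distr M borel X = distr (Pi\<^sub>M UNIV P) borel (\<lambda>x. \<chi> i. x i)"
    unfolding joint[symmetric] by (subst distr_distr[OF measurable_vec_lambda m]) (simp add: comp_def restrict_def)
  moreover have mP: "(\<lambda>x. \<chi> i. x i) \<in> borel_measurable (Pi\<^sub>M UNIV P)"
    unfolding joint[symmetric] using measurable_vec_lambda by simp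
  ultimately have "(\<integral>\<^sup>+ x. h (x + u) \<partial>distr M borel X) = (\<integral>\<^sup>+ x. h ((\<chi> i. x i) + u) \<partial>Pi\<^sub>M UNIV P)"
    using h by (simp add: nn_integral_distr)
  also have "\<dots> = (\<integral>\<^sup>+ x. h (\<chi> i. (\<lambda>i\<in>UNIV. x i + u $ i) i) \<partial>Pi\<^sub>M UNIV P)"
    by (intro nn_integral_cong arg_cong[where f = h]) (simp add: vec_eq_iff)
  also have "\<dots> \<le> (\<Prod>i\<in>(UNIV :: 'd set). ennreal (1 + 2 * a * f 0)) * (\<integral>\<^sup>+ x. h (\<chi> i. x i) \<partial>Pi\<^sub>M UNIV Q)"
  proof (rule nn_integral_PiM_le[OF _ P Q, where \<tau> = "\<lambda>i x. x + u $ i" and h = "\<lambda>x. h (\<chi> i. x i)"])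
    show "(\<lambda>x. x + u $ i) \<in> measurable (P i) (Q i)" for i
      using setsQ by (simp add: P_def cong: measurable_cong_sets)
    show "(\<integral>\<^sup>+ x. h' (x + u $ i) \<partial>P i) \<le> ennreal (1 + 2 * a * f 0) * (\<integral>\<^sup>+ x. h' x \<partial>Q i)"
      if "h' \<in> borel_measurable (Q i)" for h' i
      unfolding P_def Q_def
      using that setsQ nn_integral_shift_le_envelope_measure[OF f nonneg even mono u, of h']
      by (simp cong: measurable_cong_sets)
    show "(\<lambda>x. h (\<chi> i. x i)) \<in> borel_measurable (Pi\<^sub>M UNIV Q)"
      unfolding Q_def by (rule measurable_compose[OF measurable_vec_lambda_envelope h])
  qed simp
  also have "(\<integral>\<^sup>+ x. h (\<chi> i. x i) \<partial>Pi\<^sub>M UNIV Q) = (\<integral>\<^sup>+ x. h x \<partial>envelope_noise f a)"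
    unfolding envelope_noise_def Q_def
    using nn_integral_distr[OF measurable_vec_lambda_envelope, of h] h by simp
  finally show ?thesis by simp
qed

section \<open>From a comparison of noise laws to leakage\<close>

lemma (in prob_space) distr_history_indep_vars:
  assumes indep: "indep_vars (\<lambda>_. B) X {1..T}"
  shows "distr M (history_space B T) (history X T) = Pi\<^sub>M {1..T} (\<lambda>t. distr M B (X t))"
proof (cases "T = 0")
  case True
  \<comment> \<open>On the empty index set both sides are the point mass at the only point of the
    product.\<close>
  have "history X 0 = (\<lambda>_ _. undefined)" by (auto simp: history_def fun_eq_iff)
  then have "distr M (Pi\<^sub>M {} (\<lambda>_. B)) (history X 0) = Pi\<^sub>M {} (\<lambda>t. distr M B (X t))"
    by (intro measure_eqI) (auto simp: PiM_empty emeasure_distr subset_singleton_iff emeasure_space_1)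
  then show ?thesis using True by simp
next
  case False
  have rv: "random_variable B (X t)" if "t \<in> {1..T}" for t
    using indep that unfolding indep_vars_def by blast
  have "distr M (history_space B T) (\<lambda>\<omega>. \<lambda>t\<in>{1..T}. X t \<omega>) = Pi\<^sub>M {1..T} (\<lambda>t. distr M B (X t))"
    using indep by (subst (asm) indep_vars_iff_distr_eq_PiM'[OF _ rv]) (use False in auto)
  then show ?thesis by (simp add: history_def[abs_def])
qed

text \<open>Here \<open>U\<close> is the start, \<open>X\<close> the data, \<open>Z\<close> the
  batches and \<open>\<Xi>\<close> the noise. Integrating over the noise first, \<open>le\<close>
  replaces the output map \<open>\<psi>\<close> by \<open>\<psi>'\<close>, which does not see the
  batches. As \<open>U\<close> is independent of the data and batches, the law of
  \<open>\<psi>'\<close> under the product of \<open>Q\<close> and the law of \<open>U\<close> is a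
  fixed measure that serves in the infimum.\<close>

lemma maximal_leakage_le_of_noise:
  fixes U :: "'a \<Rightarrow> 'u" and X :: "'a \<Rightarrow> 's" and Z :: "'a \<Rightarrow> 'z" and \<Xi> :: "'a \<Rightarrow> 'x"
  assumes "prob_space M"
    and ind: "indep_rv M NU U (NX \<Otimes>\<^sub>M NZ) (\<lambda>\<omega>. (X \<omega>, Z \<omega>))"
    and ind': "indep_rv M N\<Xi> \<Xi> (NU \<Otimes>\<^sub>M NX \<Otimes>\<^sub>M NZ) (\<lambda>\<omega>. (U \<omega>, X \<omega>, Z \<omega>))"
    and \<psi> [measurable]: "\<psi> \<in> measurable (N\<Xi> \<Otimes>\<^sub>M NU \<Otimes>\<^sub>M NZ) NY"
    and \<psi>' [measurable]: "\<psi>' \<in> measurable (N\<Xi> \<Otimes>\<^sub>M NU) NY"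
    and Y: "\<And>\<omega>. \<omega> \<in> space M \<Longrightarrow> Y \<omega> = \<psi> (\<Xi> \<omega>, U \<omega>, Z \<omega>)"
    and Q: "prob_space Q" and sets: "sets Q = sets N\<Xi>" and "C > 0"
    and le: "\<And>u z h. \<lbrakk>u \<in> space NU; z \<in> space NZ; h \<in> borel_measurable NY\<rbrakk> \<Longrightarrow>
      (\<integral>\<^sup>+ x. h (\<psi> (x, u, z)) \<partial>distr M N\<Xi> \<Xi>) \<le> ennreal C * (\<integral>\<^sup>+ x. h (\<psi>' (x, u)) \<partial>Q)"
  shows "maximal_leakage M NX NY X Y \<le> ereal (ln C)"
proof (rule maximal_leakage_le)
  interpret prob_space M by fact
  interpret Q: prob_space Q by fact
  note [measurable_cong] = sets
  have U [measurable]: "U \<in> measurable M NU" and \<Xi> [measurable]: "\<Xi> \<in> measurable M N\<Xi>"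
    and XZ [measurable]: "(\<lambda>\<omega>. (X \<omega>, Z \<omega>)) \<in> measurable M (NX \<Otimes>\<^sub>M NZ)"
    and V [measurable]: "(\<lambda>\<omega>. (U \<omega>, X \<omega>, Z \<omega>)) \<in> measurable M (NU \<Otimes>\<^sub>M NX \<Otimes>\<^sub>M NZ)"
    using ind ind' by (auto simp: indep_rv_def)
  show X [measurable]: "X \<in> measurable M NX" using measurable_compose[OF XZ measurable_fst] by simp
  have Z [measurable]: "Z \<in> measurable M NZ" using measurable_compose[OF XZ measurable_snd] by simp
  have "(\<lambda>\<omega>. \<psi> (\<Xi> \<omega>, U \<omega>, Z \<omega>)) \<in> measurable M NY" by measurable
  then show Ym [measurable]: "Y \<in> measurable M NY" using Y by (simp cong: measurable_cong)
  interpret PU: prob_space "distr M NU U" using U by (rule prob_space_distr)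
  interpret P\<Xi>: prob_space "distr M N\<Xi> \<Xi>" using \<Xi> by (rule prob_space_distr)
  interpret PXZ: prob_space "distr M (NX \<Otimes>\<^sub>M NZ) (\<lambda>\<omega>. (X \<omega>, Z \<omega>))" using XZ by (rule prob_space_distr)
  interpret PV: prob_space "distr M (NU \<Otimes>\<^sub>M NX \<Otimes>\<^sub>M NZ) (\<lambda>\<omega>. (U \<omega>, X \<omega>, Z \<omega>))" using V by (rule prob_space_distr)
  interpret \<Xi>V: pair_prob_space "distr M N\<Xi> \<Xi>" "distr M (NU \<Otimes>\<^sub>M NX \<Otimes>\<^sub>M NZ) (\<lambda>\<omega>. (U \<omega>, X \<omega>, Z \<omega>))" ..
  interpret UXZ: pair_prob_space "distr M NU U" "distr M (NX \<Otimes>\<^sub>M NZ) (\<lambda>\<omega>. (X \<omega>, Z \<omega>))" ..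
  interpret UQ: pair_prob_space Q "distr M NU U" ..
  let ?R = "distr (Q \<Otimes>\<^sub>M distr M NU U) NY \<psi>'"
  have \<psi>'m: "\<psi>' \<in> measurable (Q \<Otimes>\<^sub>M distr M NU U) NY" by measurable
  show R: "prob_space ?R" by (rule UQ.prob_space_distr[OF \<psi>'m])
  interpret R: prob_space ?R by fact
  show "sets ?R = sets NY" by simp
  show "C > 0" by fact
  fix E assume [measurable]: "E \<in> sets (NX \<Otimes>\<^sub>M NY)"
  define H :: "'x \<times> 'u \<times> 's \<times> 'z \<Rightarrow> ennreal" where "H = (\<lambda>(x, u, s, z). indicator E (s, \<psi> (x, u, z)))"
  define K :: "'u \<times> 's \<times> 'z \<Rightarrow> ennreal" where "K = (\<lambda>(u, s, z). \<integral>\<^sup>+ x. indicator E (s, \<psi>' (x, u)) \<partial>Q)"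
  have H [measurable]: "H \<in> borel_measurable (N\<Xi> \<Otimes>\<^sub>M NU \<Otimes>\<^sub>M NX \<Otimes>\<^sub>M NZ)"
    unfolding H_def by measurable
  have K [measurable]: "K \<in> borel_measurable (NU \<Otimes>\<^sub>M NX \<Otimes>\<^sub>M NZ)"
    unfolding K_def by measurable
  have "emeasure (distr M (NX \<Otimes>\<^sub>M NY) (\<lambda>\<omega>. (X \<omega>, Y \<omega>))) E = (\<integral>\<^sup>+ \<omega>. indicator E (X \<omega>, Y \<omega>) \<partial>M)"
    by (subst nn_integral_indicator[symmetric], simp, subst nn_integral_distr) auto
  also have "\<dots> = (\<integral>\<^sup>+ \<omega>. H (\<Xi> \<omega>, U \<omega>, X \<omega>, Z \<omega>) \<partial>M)"
    by (intro nn_integral_cong) (simp add: H_def Y)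
  also have "\<dots> = (\<integral>\<^sup>+ p. H p \<partial>distr M (N\<Xi> \<Otimes>\<^sub>M NU \<Otimes>\<^sub>M NX \<Otimes>\<^sub>M NZ) (\<lambda>\<omega>. (\<Xi> \<omega>, U \<omega>, X \<omega>, Z \<omega>)))"
    by (subst nn_integral_distr) auto
  \<comment> \<open>Independence of the noise from everything else puts its integral innermost,
    where \<open>le\<close> applies for each fixed start, data set and batch sequence.\<close>
  also have "\<dots> = (\<integral>\<^sup>+ v. \<integral>\<^sup>+ x. H (x, v) \<partial>distr M N\<Xi> \<Xi> \<partial>distr M (NU \<Otimes>\<^sub>M NX \<Otimes>\<^sub>M NZ) (\<lambda>\<omega>. (U \<omega>, X \<omega>, Z \<omega>)))"
    unfolding distr_Pair_indep_rv[OF \<open>prob_space M\<close> ind'] by (rule \<Xi>V.nn_integral_snd[symmetric]) measurable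
  also have "\<dots> \<le> (\<integral>\<^sup>+ v. ennreal C * K v \<partial>distr M (NU \<Otimes>\<^sub>M NX \<Otimes>\<^sub>M NZ) (\<lambda>\<omega>. (U \<omega>, X \<omega>, Z \<omega>)))"
  proof (rule nn_integral_mono)
    fix v assume v: "v \<in> space (distr M (NU \<Otimes>\<^sub>M NX \<Otimes>\<^sub>M NZ) (\<lambda>\<omega>. (U \<omega>, X \<omega>, Z \<omega>)))"
    obtain u s z where uz: "v = (u, s, z)" "u \<in> space NU" "s \<in> space NX" "z \<in> space NZ"
      using v by (auto simp: space_pair_measure)
    have "(\<lambda>y. indicator E (s, y) :: ennreal) \<in> borel_measurable NY"
      using uz(3) by measurable
    from le[OF uz(2,4) this] show "(\<integral>\<^sup>+ x. H (x, v) \<partial>distr M N\<Xi> \<Xi>) \<le> ennreal C * K v"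
      by (simp add: H_def K_def uz(1))
  qed
  also have "\<dots> = ennreal C * (\<integral>\<^sup>+ v. K v \<partial>distr M (NU \<Otimes>\<^sub>M NX \<Otimes>\<^sub>M NZ) (\<lambda>\<omega>. (U \<omega>, X \<omega>, Z \<omega>)))"
    by (rule nn_integral_cmult) simp
  \<comment> \<open>Independence of the start from data and batches now separates the integral over
    \<open>u\<close>, which completes \<open>?R\<close>.\<close>
  also have "(\<integral>\<^sup>+ v. K v \<partial>distr M (NU \<Otimes>\<^sub>M NX \<Otimes>\<^sub>M NZ) (\<lambda>\<omega>. (U \<omega>, X \<omega>, Z \<omega>)))
      = (\<integral>\<^sup>+ p. \<integral>\<^sup>+ u. K (u, p) \<partial>distr M NU U \<partial>distr M (NX \<Otimes>\<^sub>M NZ) (\<lambda>\<omega>. (X \<omega>, Z \<omega>)))"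
    unfolding distr_Pair_indep_rv[OF \<open>prob_space M\<close> ind] by (rule UXZ.nn_integral_snd[symmetric]) measurable
  also have "\<dots> = (\<integral>\<^sup>+ p. \<integral>\<^sup>+ y. indicator E (fst p, y) \<partial>?R \<partial>distr M (NX \<Otimes>\<^sub>M NZ) (\<lambda>\<omega>. (X \<omega>, Z \<omega>)))"
  proof (rule nn_integral_cong)
    fix p assume "p \<in> space (distr M (NX \<Otimes>\<^sub>M NZ) (\<lambda>\<omega>. (X \<omega>, Z \<omega>)))"
    then obtain s z where p: "p = (s, z)" and [measurable]: "s \<in> space NX" by (auto simp: space_pair_measure)
    have "(\<integral>\<^sup>+ y. indicator E (s, y) \<partial>?R) = (\<integral>\<^sup>+ q. indicator E (s, \<psi>' q) \<partial>(Q \<Otimes>\<^sub>M distr M NU U))"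
      by (rule nn_integral_distr[OF \<psi>'m]) measurable
    also have "\<dots> = (\<integral>\<^sup>+ u. \<integral>\<^sup>+ x. indicator E (s, \<psi>' (x, u)) \<partial>Q \<partial>distr M NU U)"
      by (rule UQ.nn_integral_snd[symmetric]) measurable
    finally show "(\<integral>\<^sup>+ u. K (u, p) \<partial>distr M NU U) = (\<integral>\<^sup>+ y. indicator E (fst p, y) \<partial>?R)"
      by (simp add: p K_def)
  qed
  \<comment> \<open>The integrand sees the pair only through its first component, so the batches
    drop out and only the law of \<open>X\<close> remains.\<close>
  also have "\<dots> = (\<integral>\<^sup>+ \<omega>. \<integral>\<^sup>+ y. indicator E (X \<omega>, y) \<partial>?R \<partial>M)"
    by (subst nn_integral_distr) (auto intro!: R.borel_measurable_nn_integral)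
  also have "\<dots> = (\<integral>\<^sup>+ s. \<integral>\<^sup>+ y. indicator E (s, y) \<partial>?R \<partial>distr M NX X)"
    by (subst nn_integral_distr) (auto intro!: R.borel_measurable_nn_integral)
  also have "\<dots> = emeasure (distr M NX X \<Otimes>\<^sub>M ?R) E"
    by (rule R.emeasure_pair_measure[symmetric]) (simp cong: sets_pair_measure_cong)
  finally show "emeasure (distr M (NX \<Otimes>\<^sub>M NY) (\<lambda>\<omega>. (X \<omega>, Y \<omega>))) E
      \<le> ennreal C * emeasure (distr M NX X \<Otimes>\<^sub>M ?R) E" .
qed fact

section \<open>Leakage of the noisy iterative algorithm\<close>

theorem theorem6:
  fixes M :: "'a measure"
    and \<mu> :: "'z measure"
    and n T :: nat
    and S :: "'a \<Rightarrow> nat \<Rightarrow> 'z"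
    and Z :: "nat \<Rightarrow> 'a \<Rightarrow> 'z multiset"
    and W \<xi> :: "nat \<Rightarrow> 'a \<Rightarrow> real ^ 'd"
    and g :: "real ^ 'd \<Rightarrow> real ^ 'd"
    and F :: "real ^ 'd \<Rightarrow> 'z multiset \<Rightarrow> real ^ 'd"
    and \<eta> :: "nat \<Rightarrow> real"
    and L :: real
    and f :: "nat \<Rightarrow> real \<Rightarrow> real"
    and N :: "'w measure"
    and \<phi> :: "(nat \<Rightarrow> real ^ 'd) \<Rightarrow> 'w"
  assumes "prob_space M"
    and "L > 0"
    and "\<forall>t\<in>{1..T}. \<eta> t > 0"
    \<comment> \<open>the data set consists of n i.i.d. samples from \<mu>\<close>
    and "prob_space \<mu>"
    and "S \<in> measurable M (Pi\<^sub>M {..<n} (\<lambda>_. \<mu>))"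
    and "prob_space.indep_vars M (\<lambda>_. \<mu>) (\<lambda>i \<omega>. S \<omega> i) {..<n}"
    and "\<forall>i<n. distr M \<mu> (\<lambda>\<omega>. S \<omega> i) = \<mu>"
    \<comment> \<open>mini-batches\<close>
    and "\<forall>t\<in>{1..T}. Z t \<in> measurable M (batch_space n \<mu>)"
    and "\<forall>t\<in>{1..T}. \<forall>\<omega>\<in>space M. Z t \<omega> \<subseteq># dataset_mset n (S \<omega>)"
    \<comment> \<open>the update rule\<close>
    and "g \<in> borel_measurable borel"
    and "(\<lambda>(w, z). F w z) \<in> borel_measurable (borel \<Otimes>\<^sub>M batch_space n \<mu>)"
    and "\<forall>t\<in>{1..T}. \<forall>\<omega>\<in>space M.
           W t \<omega> = g (W (t - 1) \<omega>) - \<eta> t *\<^sub>R F (W (t - 1) \<omega>) (Z t \<omega>) + \<xi> t \<omega>"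
    \<comment> \<open>independence of the initial point and of the noises\<close>
    and "indep_rv M borel (W 0)
           (Pi\<^sub>M {..<n} (\<lambda>_. \<mu>) \<Otimes>\<^sub>M history_space (batch_space n \<mu>) T)
           (\<lambda>\<omega>. (S \<omega>, history Z T \<omega>))"
    and "prob_space.indep_vars M (\<lambda>_. borel) \<xi> {1..T}"
    and "indep_rv M (history_space borel T) (history \<xi> T)
           (borel \<Otimes>\<^sub>M Pi\<^sub>M {..<n} (\<lambda>_. \<mu>) \<Otimes>\<^sub>M history_space (batch_space n \<mu>) T)
           (\<lambda>\<omega>. (W 0 \<omega>, S \<omega>, history Z T \<omega>))"
    \<comment> \<open>the components of each noise are i.i.d. with density f t\<close>
    and "\<forall>t\<in>{1..T}. \<forall>x. f t x \<ge> 0"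
    and "\<forall>t\<in>{1..T}. prob_space.indep_vars M (\<lambda>_. borel) (\<lambda>i \<omega>. \<xi> t \<omega> $ i) UNIV"
    and "\<forall>t\<in>{1..T}. \<forall>i. distributed M lborel (\<lambda>\<omega>. \<xi> t \<omega> $ i) (\<lambda>x. ennreal (f t x))"
    and "\<forall>t\<in>{1..T}. \<forall>x. f t (- x) = f t x"
    and "\<forall>t\<in>{1..T}. antimono_on {0..} (f t)"
    \<comment> \<open>the sampling of the next batch does not look at the iterates\<close>
    and "\<forall>t<T. \<forall>A\<in>sets (batch_space n \<mu>). AE \<omega> in M.
           cond_prob_rv M
             (history_space (batch_space n \<mu>) t \<Otimes>\<^sub>M history_space borel t \<Otimes>\<^sub>M Pi\<^sub>M {..<n} (\<lambda>_. \<mu>))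
             (\<lambda>\<omega>. (history Z t \<omega>, history W t \<omega>, S \<omega>))
             (Z (Suc t) -` A \<inter> space M) \<omega> =
           cond_prob_rv M
             (history_space (batch_space n \<mu>) t \<Otimes>\<^sub>M Pi\<^sub>M {..<n} (\<lambda>_. \<mu>))
             (\<lambda>\<omega>. (history Z t \<omega>, S \<omega>))
             (Z (Suc t) -` A \<inter> space M) \<omega>"
    and "\<forall>w. \<forall>z\<in>space (batch_space n \<mu>). infnorm (F w z) \<le> L"
    \<comment> \<open>the final output is a function of the iterates\<close>
    and "\<phi> \<in> measurable (history_space borel T) N"
  shows "maximal_leakage M (Pi\<^sub>M {..<n} (\<lambda>_. \<mu>)) N S (\<lambda>\<omega>. \<phi> (history W T \<omega>))
           \<le> ereal (\<Sum>t=1..T. real CARD('d) * ln (1 + 2 * \<eta> t * L * f t 0))"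
proof -
  note M = assms(1) and Lpos = assms(2) and \<eta>pos = assms(3)[rule_format]
    and g [measurable] = assms(10) and F = assms(11) and upd = assms(12)[rule_format]
    and indW = assms(13) and ind\<xi> = assms(14) and indV = assms(15)
    and nonneg = assms(16)[rule_format] and comp = assms(17)[rule_format]
    and dens = assms(18)[rule_format] and even = assms(19)[rule_format]
    and mono = assms(20)[rule_format] and bound = assms(22)[rule_format] and \<phi> = assms(23)
  interpret prob_space M by fact
  let ?B = "batch_space n \<mu>"
  let ?NX = "Pi\<^sub>M {..<n} (\<lambda>_. \<mu>)"
  let ?NZ = "history_space ?B T"
  let ?N\<Xi> = "history_space (borel :: (real ^ 'd) measure) T"
  define D where "D z t w = g w - \<eta> t *\<^sub>R F w (z t)" for z :: "nat \<Rightarrow> 'z multiset" and t w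
  define c where "c t = 1 + 2 * (\<eta> t * L) * f t 0" for t
  \<comment> \<open>The product lemmas ask for a probability measure at every index; the point mass
    at 0 is a filler outside \<open>{1..T}\<close>.\<close>
  define P where "P t = (if t \<in> {1..T} then distr M borel (\<xi> t) else return borel 0)" for t
  define Q where "Q t = (if t \<in> {1..T} then envelope_noise (f t) (\<eta> t * L) else return borel 0 :: (real ^ 'd) measure)" for t
  define \<psi> where "\<psi> = (\<lambda>(x, w, z). \<phi> (\<lambda>t\<in>{1..T}. noisy_path (D z) w x t))"
  define \<psi>' where "\<psi>' = (\<lambda>(x, w). \<phi> (\<lambda>t\<in>{1..T}. noisy_path (\<lambda>_. g) w x t))"
  have f: "(\<lambda>x. ennreal (f t x)) \<in> borel_measurable borel" if "t \<in> {1..T}" for t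
    using distributed_borel_measurable[OF dens[OF that, of undefined]] by simp
  have int: "(\<integral>\<^sup>+ x. ennreal (f t x) \<partial>lborel) = 1" if "t \<in> {1..T}" for t
  proof -
    \<comment> \<open>Any coordinate will do: its law is a probability measure with density
      \<open>f t\<close>, which forces total mass 1.\<close>
    have "prob_space (distr M lborel (\<lambda>\<omega>. \<xi> t \<omega> $ undefined))"
      using distributed_measurable[OF dens[OF that]] by (rule prob_space_distr)
    then have "emeasure (density lborel (\<lambda>x. ennreal (f t x))) UNIV = 1"
      unfolding distributed_distr_eq_density[OF dens[OF that]] using prob_space.emeasure_space_1 by fastforce
    then show ?thesis using f[OF that] by (simp add: emeasure_density)
  qed
  have a: "\<eta> t * L \<ge> 0" if "t \<in> {1..T}" for t
    using \<eta>pos[OF that] Lpos by simp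
  have c: "c t > 0" if "t \<in> {1..T}" for t
    using a[OF that] nonneg[OF that, of 0] by (simp add: c_def add_pos_nonneg)
  have \<xi>m: "\<xi> t \<in> borel_measurable M" if "t \<in> {1..T}" for t
    using ind\<xi> that unfolding indep_vars_def by blast
  have P: "prob_space (P t)" "sets (P t) = sets borel" for t
    by (auto simp: P_def intro!: prob_space_distr \<xi>m prob_space_return)
  have Q: "prob_space (Q t)" "sets (Q t) = sets borel" for t
    using prob_space_envelope_noise[OF f nonneg even int a, of t]
    by (auto simp: Q_def envelope_noise_def intro!: prob_space_return)
  have law: "distr M ?N\<Xi> (history \<xi> T) = Pi\<^sub>M {1..T} P"
    unfolding distr_history_indep_vars[OF ind\<xi>] by (rule PiM_cong) (auto simp: P_def)
  have Dm: "(\<lambda>(z, w). D z t w) \<in> borel_measurable (?NZ \<Otimes>\<^sub>M borel)" if "t \<in> {1..T}" for t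
  proof -
    have "(\<lambda>p. (snd p, fst p t)) \<in> measurable (?NZ \<Otimes>\<^sub>M borel) (borel \<Otimes>\<^sub>M ?B)"
      using measurable_compose[OF measurable_fst measurable_component_singleton[OF that]] by measurable
    from measurable_compose[OF this F] show ?thesis
      unfolding D_def case_prod_beta' by simp
  qed
  have coord: "(\<lambda>p. fst p t) \<in> borel_measurable (?N\<Xi> \<Otimes>\<^sub>M R)" if "t \<in> {1..T}" for t R
    using measurable_compose[OF measurable_fst measurable_component_singleton[OF that]] .
  \<comment> \<open>Unrolling the update rule: on each outcome the iterates are determined by the
    start, the batches and the noise, with the direction term absorbed into the drift
    \<open>D\<close>.\<close>
  have path: "W t \<omega> = noisy_path (D (history Z T \<omega>)) (W 0 \<omega>) (history \<xi> T \<omega>) t"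
    if "\<omega> \<in> space M" "t \<le> T" for t \<omega>
    using that(2)
  proof (induction t)
    case (Suc t)
    then show ?case using upd[OF _ that(1), of "Suc t"] by (simp add: D_def history_def)
  qed simp
  have "maximal_leakage M ?NX N S (\<lambda>\<omega>. \<phi> (history W T \<omega>)) \<le> ereal (ln (\<Prod>t=1..T. c t ^ CARD('d)))"
  proof (rule maximal_leakage_le_of_noise[OF M indW indV, where \<psi> = \<psi> and \<psi>' = \<psi>' and Q = "Pi\<^sub>M {1..T} Q"])
    show "\<psi> \<in> measurable (?N\<Xi> \<Otimes>\<^sub>M borel \<Otimes>\<^sub>M ?NZ) N"
      unfolding \<psi>_def case_prod_beta'
    proof (rule measurable_compose[OF measurable_restrict \<phi>])
      fix t assume "t \<in> {1..T}"
      then have "t \<le> T" by simp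
      show "(\<lambda>p. noisy_path (D (snd (snd p))) (fst (snd p)) (fst p) t)
          \<in> borel_measurable (?N\<Xi> \<Otimes>\<^sub>M borel \<Otimes>\<^sub>M ?NZ)"
      proof (rule measurable_noisy_path[where D = D and A = ?NZ and n = T])
        show "(\<lambda>(z, w). D z t w) \<in> borel_measurable (?NZ \<Otimes>\<^sub>M borel)" if "t \<in> {1..T}" for t
          by (rule Dm[OF that])
        show "(\<lambda>p. snd (snd p)) \<in> measurable (?N\<Xi> \<Otimes>\<^sub>M borel \<Otimes>\<^sub>M ?NZ) ?NZ"
          by (rule measurable_compose[OF measurable_snd measurable_snd])
        show "(\<lambda>p. fst (snd p)) \<in> borel_measurable (?N\<Xi> \<Otimes>\<^sub>M borel \<Otimes>\<^sub>M ?NZ)"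
          by (rule measurable_compose[OF measurable_snd measurable_fst])
        show "(\<lambda>p. fst p t) \<in> borel_measurable (?N\<Xi> \<Otimes>\<^sub>M borel \<Otimes>\<^sub>M ?NZ)" if "t \<in> {1..T}" for t
          by (rule coord[OF that])
      qed fact
    qed
    show "\<psi>' \<in> measurable (?N\<Xi> \<Otimes>\<^sub>M borel) N"
      unfolding \<psi>'_def case_prod_beta'
    proof (rule measurable_compose[OF measurable_restrict \<phi>])
      fix t assume "t \<in> {1..T}"
      then have "t \<le> T" by simp
      show "(\<lambda>p. noisy_path (\<lambda>_. g) (snd p) (fst p) t) \<in> borel_measurable (?N\<Xi> \<Otimes>\<^sub>M borel)"
      proof (rule measurable_noisy_path[where D = "\<lambda>_ _. g" and v = "\<lambda>_. ()"
            and A = "count_space UNIV" and n = T])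
        show "(\<lambda>p. fst p t) \<in> borel_measurable (?N\<Xi> \<Otimes>\<^sub>M borel)" if "t \<in> {1..T}" for t
          by (rule coord[OF that])
        show "t \<le> T" by fact
      qed simp_all
    qed
    show "\<phi> (history W T \<omega>) = \<psi> (history \<xi> T \<omega>, W 0 \<omega>, history Z T \<omega>)" if "\<omega> \<in> space M" for \<omega>
    proof -
      have "history W T \<omega> = (\<lambda>t\<in>{1..T}. noisy_path (D (history Z T \<omega>)) (W 0 \<omega>) (history \<xi> T \<omega>) t)"
        unfolding history_def[of W] by (intro restrict_ext path that) simp
      then show ?thesis by (simp add: \<psi>_def)
    qed
    show "prob_space (Pi\<^sub>M {1..T} Q)" by (intro prob_space_PiM Q)
    show "sets (Pi\<^sub>M {1..T} Q) = sets ?N\<Xi>" by (intro sets_PiM_cong Q refl)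
    show "0 < (\<Prod>t=1..T. c t ^ CARD('d))" using c by (intro prod_pos) auto
    fix w z and h :: "'w \<Rightarrow> ennreal"
    assume z: "z \<in> space ?NZ" and h: "h \<in> borel_measurable N"
    have zt: "z t \<in> space ?B" if "t \<in> {1..T}" for t
      using z that by (auto simp: space_PiM)
    \<comment> \<open>The output sees times 1 to \<open>T\<close>, whereas the path comparison
      carries time 0; restriction bridges the two.\<close>
    define h' where "h' v = h (\<phi> (restrict v {1..T}))" for v
    have "{1..T} \<subseteq> {0..T}" by auto
    from measurable_compose[OF measurable_compose[OF measurable_restrict_subset[OF this] \<phi>] h]
    have h': "h' \<in> borel_measurable (Pi\<^sub>M {0..T} (\<lambda>_. borel))" unfolding h'_def .
    have "restrict (restrict v {0..T}) {1..T} = restrict v {1..T}" for v :: "nat \<Rightarrow> real ^ 'd"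
      by (auto simp: restrict_def fun_eq_iff)
    then have h'_path: "h' (\<lambda>t\<in>{0..T}. noisy_path E w x t) = h (\<phi> (\<lambda>t\<in>{1..T}. noisy_path E w x t))" for E x
      unfolding h'_def by simp
    have "(\<integral>\<^sup>+ x. h (\<psi> (x, w, z)) \<partial>distr M ?N\<Xi> (history \<xi> T))
        = (\<integral>\<^sup>+ x. h' (\<lambda>t\<in>{0..T}. noisy_path (D z) w x t) \<partial>Pi\<^sub>M {1..T} P)"
      unfolding law h'_path by (simp add: \<psi>_def)
    also have "\<dots> \<le> (\<Prod>t=1..T. ennreal (c t) ^ CARD('d))
        * (\<integral>\<^sup>+ x. h' (\<lambda>t\<in>{0..T}. noisy_path (\<lambda>_. g) w x t) \<partial>Pi\<^sub>M {1..T} Q)"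
    proof (rule nn_integral_noisy_path_le[OF P Q _ g _ h'])
      fix t assume t: "t \<in> {1..T}"
      show "D z t \<in> borel_measurable borel"
        using measurable_compose[OF measurable_Pair1'[OF z] Dm[OF t]] by simp
      fix w and k :: "real ^ 'd \<Rightarrow> ennreal" assume k [measurable]: "k \<in> borel_measurable borel"
      \<comment> \<open>Only the direction term counts as a shift of the noise, and the sup-norm
        bound controls each of its coordinates.\<close>
      have u: "\<bar>(- (\<eta> t *\<^sub>R F w (z t))) $ i\<bar> \<le> \<eta> t * L" for i
        using component_le_infnorm_cart[of "F w (z t)" i] bound[OF zt[OF t], of w] \<eta>pos[OF t]
        by (simp add: abs_mult)
      \<comment> \<open>The drift \<open>g w\<close> is common to both paths, so it is absorbed into
        the test function by translating \<open>k\<close>.\<close>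
      have "(\<integral>\<^sup>+ x. k (g w + (x + - (\<eta> t *\<^sub>R F w (z t)))) \<partial>distr M borel (\<xi> t))
          \<le> ennreal (1 + 2 * (\<eta> t * L) * f t 0) ^ CARD('d)
            * (\<integral>\<^sup>+ x. k (g w + x) \<partial>envelope_noise (f t) (\<eta> t * L))"
        by (rule nn_integral_shift_le_envelope_noise[OF M comp[OF t] dens[OF t] f[OF t] nonneg[OF t]
              even[OF t] int[OF t] mono[OF t] u]) measurable
      then show "(\<integral>\<^sup>+ x. k (D z t w + x) \<partial>P t) \<le> ennreal (c t) ^ CARD('d) * (\<integral>\<^sup>+ x. k (g w + x) \<partial>Q t)"
        using t by (simp add: P_def Q_def c_def D_def algebra_simps)
    qed
    also have "(\<Prod>t=1..T. ennreal (c t) ^ CARD('d)) = ennreal (\<Prod>t=1..T. c t ^ CARD('d))"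
      using c by (subst prod_ennreal[symmetric]) (auto intro!: prod.cong simp: ennreal_power less_imp_le)
    also have "(\<integral>\<^sup>+ x. h' (\<lambda>t\<in>{0..T}. noisy_path (\<lambda>_. g) w x t) \<partial>Pi\<^sub>M {1..T} Q)
        = (\<integral>\<^sup>+ x. h (\<psi>' (x, w)) \<partial>Pi\<^sub>M {1..T} Q)"
      unfolding h'_path by (simp add: \<psi>'_def)
    finally show "(\<integral>\<^sup>+ x. h (\<psi> (x, w, z)) \<partial>distr M ?N\<Xi> (history \<xi> T))
        \<le> ennreal (\<Prod>t=1..T. c t ^ CARD('d)) * (\<integral>\<^sup>+ x. h (\<psi>' (x, w)) \<partial>Pi\<^sub>M {1..T} Q)" .
  qed
  also have "ln (\<Prod>t=1..T. c t ^ CARD('d)) = (\<Sum>t=1..T. ln (c t ^ CARD('d)))"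
  proof (rule ln_prod)
    show "c t ^ CARD('d) \<noteq> 0" if "t \<in> {1..T}" for t
      using c[OF that] by simp
  qed simp
  also have "\<dots> = (\<Sum>t=1..T. real CARD('d) * ln (1 + 2 * \<eta> t * L * f t 0))"
    using c by (intro sum.cong) (auto simp: ln_realpow c_def mult.assoc)
  finally show ?thesis .
qed

end
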